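(* Let $A\in\mathbb{R}^{n\times n}$ be symmetric with eigenvalues $\alpha_1\ge\cdots\ge\alpha_n$, let $g\in\mathbb{R}^n$ be nonzero, $\Delta>0$, and consider the trust-region subproblem (TRS) of minimizing $f(x)=\frac12x^TAx+x^Tg$ subject to $\|x\|\le\Delta$, in the easy case. Let $x_{opt},\lambda_{opt}$, $A_{opt}$, $\kappa$, $Q_k$, $x_k$, $k_{\max}$ and $\epsilon_k$ be as in the context. If $\|x_{opt}\|=\|x_k\|=\Delta$ for $k\in\{1,2,\ldots,k_{\max}\}$, then $$0\le f(x_k)-f(x_{opt})\le \frac12\|A_{opt}\|\Big(1+\frac{\epsilon_k^2}{\Delta^2}\Big)\epsilon_k^2\le 2\|A_{opt}\|(\Delta^2+\epsilon_k^2)\Big(\frac{\sqrt\kappa-1}{\sqrt\kappa+1}\Big)^{2k},$$ and $$\|x_k-x_{opt}\|\le\sqrt{\kappa\Big(1+\frac{\epsilon_k^2}{\Delta^2}\Big)}\,\epsilon_k\le 2\sqrt{\kappa(\Delta^2+\epsilon_k^2)}\Big(\frac{\sqrt\kappa-1}{\sqrt\kappa+1}\Big)^{k}.$$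
   Context: All norms are Euclidean. $x_{opt}$ is a global minimizer of the TRS and $\lambda_{opt}\ge0$ its Lagrange multiplier: $(A+\lambda_{opt}I)x_{opt}=-g$, $\lambda_{opt}(\Delta-\|x_{opt}\|)=0$, $A+\lambda_{opt}I\succeq0$. Easy case means $\lambda_{opt}>-\alpha_n$ (so $A+\lambda_{opt}I\succ0$ and $x_{opt}$ is unique). Set $A_{opt}=A+\lambda_{opt}I$ and $\kappa=(\alpha_1+\lambda_{opt})/(\alpha_n+\lambda_{opt})$. The Lanczos process on $A$ with starting vector $g$ produces $Q_k=[q_1,\ldots,q_k]$ with orthonormal columns spanning the Krylov subspace $\mathcal{K}_k(A,g)=\mathrm{span}\{g,Ag,\ldots,A^{k-1}g\}$, $q_1=g/\|g\|$, the symmetric tridiagonal $T_k=Q_k^TAQ_k$, and $AQ_k=Q_kT_k+\beta_kq_{k+1}e_k^T$ ($e_k$ the $k$-th unit vector, $\beta_k\ge0$); $k_{\max}$ is the first step at which the Lanczos process breaks down. The GLTR iterate is $x_k=Q_kh_k$, where $h_k$ minimizes $\frac12h^TT_kh+\|g\|h^Te_1$ over $\|h\|\le\Delta$, with Lagrange multiplier $\lambda_k\ge0$: $(T_k+\lambda_kI)h_k=-\|g\|e_1$, $\lambda_k(\Delta-\|h_k\|)=0$, $T_k+\lambda_kI\succeq0$ (this reduced problem has a unique solution). Finally $\epsilon_k=\min_{x\in\mathcal{K}_k(A,g)}\|x-x_{opt}\|=\|(I-Q_kQ_k^T)x_{opt}\|$. *)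

theory Defs
  imports "HOL-Analysis.Analysis"
begin

text \<open>Objective of the trust-region subproblem: f(x) = 1/2 x^T A x + x^T g.\<close>
definition trs_obj :: "real^'n^'n \<Rightarrow> real^'n \<Rightarrow> real^'n \<Rightarrow> real" where
  "trs_obj A g x = (1/2) * (x \<bullet> (A *v x)) + x \<bullet> g"

text \<open>Set of (real) eigenvalues of a square matrix.\<close>
definition eigvals :: "real^'n^'n \<Rightarrow> real set" where
  "eigvals A = {a. \<exists>v. v \<noteq> 0 \<and> A *v v = a *\<^sub>R v}"

text \<open>Largest (alpha_1) and smallest (alpha_n) eigenvalue.\<close>
definition alpha_max :: "real^'n^'n \<Rightarrow> real" where
  "alpha_max A = Max (eigvals A)"
definition alpha_min :: "real^'n^'n \<Rightarrow> real" where
  "alpha_min A = Min (eigvals A)"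

text \<open>Krylov subspace K_k(A,g) = span {g, Ag, ..., A^(k-1) g}.\<close>
definition krylov :: "real^'n^'n \<Rightarrow> real^'n \<Rightarrow> nat \<Rightarrow> (real^'n) set" where
  "krylov A g k = span {((\<lambda>v. A *v v) ^^ j) g | j. j < k}"

text \<open>k_max: the first step k at which the Lanczos process breaks down
  (beta_k = 0), i.e. the first k \<ge> 1 with K_(k+1) = K_k.\<close>
definition kmax :: "real^'n^'n \<Rightarrow> real^'n \<Rightarrow> nat" where
  "kmax A g = (LEAST k. 1 \<le> k \<and> krylov A g (Suc k) = krylov A g k)"

text \<open>q 1, ..., q k are the first k Lanczos vectors of A with starting vector g:
  orthonormal, q_1 = g/||g||, span{q_1..q_j} = K_j(A,g) for j = 1..k, and the
  off-diagonal entries beta_j = q_(j+1)^T A q_j are nonnegative.\<close>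
definition lanczos_vectors :: "real^'n^'n \<Rightarrow> real^'n \<Rightarrow> nat \<Rightarrow> (nat \<Rightarrow> real^'n) \<Rightarrow> bool" where
  "lanczos_vectors A g k q \<longleftrightarrow>
     q 1 = (1 / norm g) *\<^sub>R g \<and>
     (\<forall>i\<in>{1..k}. \<forall>j\<in>{1..k}. q i \<bullet> q j = (if i = j then 1 else 0)) \<and>
     (\<forall>j\<in>{1..k}. span (q ` {1..j}) = krylov A g j) \<and>
     (\<forall>j\<in>{1..<k}. 0 \<le> q (Suc j) \<bullet> (A *v q j))"

text \<open>Tridiagonal T_k = Q_k^T A Q_k, entries indexed by 1..k.\<close>
definition lanczos_T :: "real^'n^'n \<Rightarrow> (nat \<Rightarrow> real^'n) \<Rightarrow> nat \<Rightarrow> nat \<Rightarrow> real" where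
  "lanczos_T A q i j = q i \<bullet> (A *v q j)"

text \<open>Reduced objective 1/2 h^T T_k h + ||g|| h^T e_1 for h in R^k (indices 1..k).\<close>
definition red_obj :: "real^'n^'n \<Rightarrow> real^'n \<Rightarrow> (nat \<Rightarrow> real^'n) \<Rightarrow> nat \<Rightarrow> (nat \<Rightarrow> real) \<Rightarrow> real" where
  "red_obj A g q k h =
     (1/2) * (\<Sum>i=1..k. \<Sum>j=1..k. h i * lanczos_T A q i j * h j) + norm g * h 1"

text \<open>Euclidean norm of h in R^k (indices 1..k).\<close>
definition knorm :: "nat \<Rightarrow> (nat \<Rightarrow> real) \<Rightarrow> real" where
  "knorm k h = sqrt (\<Sum>i=1..k. (h i)^2)"

text \<open>x_k = Q_k h.\<close>
definition lanczos_lift :: "(nat \<Rightarrow> real^'n) \<Rightarrow> nat \<Rightarrow> (nat \<Rightarrow> real) \<Rightarrow> real^'n" where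
  "lanczos_lift q k h = (\<Sum>i=1..k. h i *\<^sub>R q i)"

end

(*
  On the sphere |y| = \<Delta> through x_opt, the stationarity equation A_opt x_opt = -g gives
  f(y) - f(x_opt) = 1/2 (y - x_opt)\<^sup>T A_opt (y - x_opt).  The GLTR iterate x_k minimises f over
  the trust region intersected with K_k, so it does at least as well as the point of K_k on
  the sphere obtained by rescaling the orthogonal projection of x_opt onto K_k; that point is
  within distance sqrt(1 + \<epsilon>\<^sub>k\<^sup>2/\<Delta>\<^sup>2) \<epsilon>\<^sub>k of x_opt, which gives the bound on the objective, and
  the lower eigenvalue bound \<alpha>\<^sub>n + \<lambda>_opt of A_opt turns it into the bound on |x_k - x_opt|.

  For the rates, let L be the affine image of A_opt mapping [\<alpha>\<^sub>n + \<lambda>_opt, \<alpha>\<^sub>1 + \<lambda>_opt] onto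
  [-1, 1] and T\<^sub>k the Chebyshev polynomial.  Since A_opt x_opt = -g, the vector T\<^sub>k(L) x_opt is
  congruent to T\<^sub>k(z) x_opt modulo K_k, where z = (\<kappa> + 1)/(\<kappa> - 1), while its norm is at most \<Delta>.
  Dividing by T\<^sub>k(z) > ((sqrt \<kappa> + 1)/(sqrt \<kappa> - 1))\<^sup>k / 2 yields
  \<epsilon>\<^sub>k \<le> 2 ((sqrt \<kappa> - 1)/(sqrt \<kappa> + 1))\<^sup>k \<Delta>.  When \<kappa> = 1 there is no such L, but then A_opt is
  scalar and x_opt already lies in K_1.
*)

theory Submission
  imports Defs
begin

section \<open>The spectral theorem for symmetric matrices\<close>

definition orthonormal_on :: "'i set \<Rightarrow> ('i \<Rightarrow> 'a::real_inner) \<Rightarrow> bool" where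
  "orthonormal_on I e \<longleftrightarrow> (\<forall>i\<in>I. \<forall>j\<in>I. e i \<bullet> e j = (if i = j then 1 else 0))"

lemma orthonormal_on_inner_sum:
  assumes "finite I" "orthonormal_on I e" "j \<in> I"
  shows "(\<Sum>i\<in>I. c i *\<^sub>R e i) \<bullet> e j = c j"
proof -
  have "(\<Sum>i\<in>I. c i *\<^sub>R e i) \<bullet> e j = (\<Sum>i\<in>I. c i * (if i = j then 1 else 0))"
    using assms by (simp add: inner_sum_left orthonormal_on_def)
  also have "\<dots> = c j"
    using assms by (simp add: if_distrib cong: if_cong)
  finally show ?thesis .
qed

lemma orthonormal_on_inner_sum_self:
  assumes "finite I" "orthonormal_on I e"
  shows "(\<Sum>i\<in>I. c i *\<^sub>R e i) \<bullet> (\<Sum>i\<in>I. c i *\<^sub>R e i) = (\<Sum>i\<in>I. (c i)\<^sup>2)"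
  using orthonormal_on_inner_sum[OF assms]
  by (simp add: inner_sum_right power2_eq_square)

lemma orthonormal_on_expansion:
  assumes "finite I" "orthonormal_on I e" "v \<in> span (e ` I)"
  shows "v = (\<Sum>i\<in>I. (v \<bullet> e i) *\<^sub>R e i)"
proof -
  define d where "d = v - (\<Sum>i\<in>I. (v \<bullet> e i) *\<^sub>R e i)"
  have "d \<in> span (e ` I)"
    unfolding d_def using assms(3)
    by (intro span_diff span_sum span_scale) (auto intro: span_base)
  moreover have "orthogonal d w" if "w \<in> e ` I" for w
    using that orthonormal_on_inner_sum[OF assms(1,2)]
    by (auto simp: d_def orthogonal_def inner_diff_left)
  ultimately have "orthogonal d d"
    using orthogonal_to_span by blast
  then show ?thesis
    by (simp add: d_def orthogonal_def)
qed

lemma symmetric_matrix_inner: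
  fixes M :: "real^'n^'n"
  assumes "transpose M = M"
  shows "x \<bullet> (M *v y) = (M *v x) \<bullet> y"
  by (metis assms dot_lmul_matrix vector_transpose_matrix)

lemma nonneg_quadratic_linear_coeff_zero:
  fixes b c :: real
  assumes "\<And>t. 0 \<le> 2 * t * b + t\<^sup>2 * c"
  shows "b = 0"
proof -
  define D where "D = \<bar>c\<bar> + 1"
  have D: "D > 0" "c - 2 * D < 0"
    unfolding D_def by auto
  have "0 \<le> (2 * (- b / D) * b + (- b / D)\<^sup>2 * c) * D\<^sup>2"
    using assms[of "- b / D"] by simp
  also have "\<dots> = b\<^sup>2 * (c - 2 * D)"
    using D by (simp add: field_simps power2_eq_square)
  finally have "b\<^sup>2 \<le> 0"
    using D by (simp add: zero_le_mult_iff)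
  then show ?thesis
    by simp
qed

text \<open>The first variation of the Rayleigh quotient in the direction of the residual
  \<open>M u - \<mu> u\<close> vanishes.\<close>

lemma symmetric_rayleigh_min_eigenvector:
  fixes M :: "real^'n^'n"
  assumes sym: "transpose M = M" and S: "subspace S" and inv: "\<And>v. v \<in> S \<Longrightarrow> M *v v \<in> S"
    and u: "u \<in> S" "u \<bullet> u = 1"
    and min: "\<And>v. v \<in> S \<Longrightarrow> (u \<bullet> (M *v u)) * (v \<bullet> v) \<le> v \<bullet> (M *v v)"
  shows "M *v u = (u \<bullet> (M *v u)) *\<^sub>R u"
proof -
  define \<mu> where "\<mu> = u \<bullet> (M *v u)"
  define e where "e = M *v u - \<mu> *\<^sub>R u"
  have eS: "e \<in> S"
    unfolding e_def using u inv S by (simp add: subspace_diff subspace_scale)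
  have "0 \<le> 2 * t * (e \<bullet> e) + t\<^sup>2 * (e \<bullet> (M *v e) - \<mu> * (e \<bullet> e))" for t
  proof -
    have "u + t *\<^sub>R e \<in> S"
      using u eS S by (simp add: subspace_add subspace_scale)
    then have le: "\<mu> * ((u + t *\<^sub>R e) \<bullet> (u + t *\<^sub>R e)) \<le> (u + t *\<^sub>R e) \<bullet> (M *v (u + t *\<^sub>R e))"
      using min unfolding \<mu>_def by blast
    have "e \<bullet> (M *v u) = u \<bullet> (M *v e)"
      using symmetric_matrix_inner[OF sym] by (simp add: inner_commute)
    moreover have "e \<bullet> (M *v u) - \<mu> * (e \<bullet> u) = e \<bullet> e"
      unfolding e_def by (simp add: inner_diff_left inner_diff_right algebra_simps inner_commute)
    ultimately have "(u + t *\<^sub>R e) \<bullet> (M *v (u + t *\<^sub>R e)) - \<mu> * ((u + t *\<^sub>R e) \<bullet> (u + t *\<^sub>R e))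
        = 2 * t * (e \<bullet> e) + t\<^sup>2 * (e \<bullet> (M *v e) - \<mu> * (e \<bullet> e))"
      using u(2) unfolding \<mu>_def
      by (simp add: matrix_vector_right_distrib matrix_vector_mult_scaleR inner_add_left
          inner_add_right algebra_simps power2_eq_square inner_commute)
    then show ?thesis
      using le by linarith
  qed
  then have "e \<bullet> e = 0"
    by (rule nonneg_quadratic_linear_coeff_zero)
  then show ?thesis
    by (simp add: e_def \<mu>_def)
qed

lemma symmetric_invariant_subspace_eigenvector:
  fixes M :: "real^'n^'n"
  assumes sym: "transpose M = M" and S: "subspace S" and inv: "\<And>v. v \<in> S \<Longrightarrow> M *v v \<in> S"
    and "v0 \<in> S" "v0 \<noteq> 0"
  obtains u \<mu> where "u \<in> S" "u \<bullet> u = 1" "M *v u = \<mu> *\<^sub>R u"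
proof -
  let ?K = "S \<inter> sphere 0 1"
  have "compact (sphere 0 1 \<inter> S)"
    by (rule compact_Int_closed[OF compact_sphere closed_subspace[OF S]])
  then have "compact ?K"
    by (simp add: Int_commute)
  moreover have "(1 / norm v0) *\<^sub>R v0 \<in> ?K"
    using assms(4,5) S by (simp add: subspace_scale)
  moreover have "continuous_on ?K (\<lambda>v. v \<bullet> (M *v v))"
    by (intro continuous_intros linear_continuous_on matrix_vector_mul_bounded_linear)
  ultimately obtain u where u: "u \<in> ?K" and umin: "\<And>y. y \<in> ?K \<Longrightarrow> u \<bullet> (M *v u) \<le> y \<bullet> (M *v y)"
    using continuous_attains_inf[of ?K "\<lambda>v. v \<bullet> (M *v v)"] by blast
  have uS: "u \<in> S" and uu: "u \<bullet> u = 1"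
    using u by (simp_all add: norm_eq_1)
  have min: "(u \<bullet> (M *v u)) * (v \<bullet> v) \<le> v \<bullet> (M *v v)" if "v \<in> S" for v
  proof (cases "v = 0")
    case False
    have "(1 / norm v) *\<^sub>R v \<in> ?K"
      using that False S by (simp add: subspace_scale)
    then have "u \<bullet> (M *v u) \<le> ((1 / norm v) *\<^sub>R v) \<bullet> (M *v ((1 / norm v) *\<^sub>R v))"
      by (rule umin)
    also have "\<dots> = (v \<bullet> (M *v v)) / (norm v)\<^sup>2"
      by (simp add: matrix_vector_mult_scaleR power2_eq_square)
    finally show ?thesis
      using False by (simp add: field_simps dot_square_norm)
  qed simp
  show ?thesis
    using symmetric_rayleigh_min_eigenvector[OF sym S inv uS uu min] by (rule that[OF uS uu])
qed

lemma symmetric_invariant_subspace_eigenbasis: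
  fixes M :: "real^'n^'n"
  assumes sym: "transpose M = M"
  shows "subspace S \<Longrightarrow> (\<And>v. v \<in> S \<Longrightarrow> M *v v \<in> S) \<Longrightarrow>
    \<exists>U. finite U \<and> U \<subseteq> S \<and> orthonormal_on U id \<and> (\<forall>u\<in>U. M *v u = (u \<bullet> (M *v u)) *\<^sub>R u)
      \<and> S \<subseteq> span U"
proof (induction "dim S" arbitrary: S rule: less_induct)
  case less
  show ?case
  proof (cases "S \<subseteq> {0}")
    case True
    then show ?thesis
      by (intro exI[of _ "{}"]) (auto simp: orthonormal_on_def)
  next
    case False
    then obtain v0 where "v0 \<in> S" "v0 \<noteq> 0"
      by auto
    then obtain u \<mu> where u: "u \<in> S" "u \<bullet> u = 1" "M *v u = \<mu> *\<^sub>R u"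
      using symmetric_invariant_subspace_eigenvector[OF sym less.prems] by blast
    define S' where "S' = {v \<in> S. v \<bullet> u = 0}"
    have sub': "subspace S'"
      using less.prems(1) unfolding S'_def subspace_def by (auto simp: inner_add_left)
    have inv': "M *v v \<in> S'" if "v \<in> S'" for v
    proof -
      have "(M *v v) \<bullet> u = v \<bullet> (M *v u)"
        using symmetric_matrix_inner[OF sym] by (simp add: inner_commute)
      also have "\<dots> = 0"
        using that unfolding S'_def by (simp add: u(3) inner_commute)
      finally show ?thesis
        using that less.prems(2) unfolding S'_def by auto
    qed
    have "S' \<subset> S"
      using u(1,2) unfolding S'_def by force
    moreover have "span S' = S'" "span S = S"
      using sub' less.prems(1) by (simp_all add: span_eq_iff)
    ultimately have "dim S' < dim S"
      using dim_psubset by metis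
    then obtain U where U: "finite U" "U \<subseteq> S'" "orthonormal_on U id"
      "\<forall>w\<in>U. M *v w = (w \<bullet> (M *v w)) *\<^sub>R w" "S' \<subseteq> span U"
      using less.hyps[OF _ sub' inv'] by blast
    have "u \<notin> U"
      using U(2) u(2) unfolding S'_def by auto
    then have orth: "orthonormal_on (insert u U) id"
      using U(2,3) u(2) unfolding S'_def orthonormal_on_def by (auto simp: inner_commute)
    have "S \<subseteq> span (insert u U)"
    proof
      fix v assume v: "v \<in> S"
      have "v - (v \<bullet> u) *\<^sub>R u \<in> S'"
        unfolding S'_def using v u less.prems(1)
        by (simp add: subspace_diff subspace_scale inner_diff_left)
      then have "v - (v \<bullet> u) *\<^sub>R u \<in> span (insert u U)"
        using U(5) span_mono[of U "insert u U"] by auto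
      moreover have "(v \<bullet> u) *\<^sub>R u \<in> span (insert u U)"
        by (intro span_scale span_base) simp
      ultimately have "v - (v \<bullet> u) *\<^sub>R u + (v \<bullet> u) *\<^sub>R u \<in> span (insert u U)"
        by (rule span_add)
      then show "v \<in> span (insert u U)"
        by simp
    qed
    then show ?thesis
      using U u orth unfolding S'_def by (intro exI[of _ "insert u U"]) auto
  qed
qed

text \<open>The spectral theorem, in coordinates with respect to an orthonormal eigenbasis \<open>U\<close>
  (eigenvalue \<open>\<mu> u\<close> at \<open>u\<close>).\<close>

lemma symmetric_matrix_eigenbasis:
  fixes M :: "real^'n^'n"
  assumes sym: "transpose M = M"
  obtains U :: "(real^'n) set" and \<mu> where "finite U" "eigvals M = \<mu> ` U"
    "\<And>v w. v \<bullet> w = (\<Sum>u\<in>U. (v \<bullet> u) * (w \<bullet> u))"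
    "\<And>u v. u \<in> U \<Longrightarrow> (M *v v) \<bullet> u = \<mu> u * (v \<bullet> u)"
proof -
  obtain U where U: "finite U" "orthonormal_on U id" "\<forall>u\<in>U. M *v u = (u \<bullet> (M *v u)) *\<^sub>R u"
      "UNIV \<subseteq> span U"
    using symmetric_invariant_subspace_eigenbasis[OF sym, of UNIV] by auto
  define \<mu> where "\<mu> u = u \<bullet> (M *v u)" for u
  have expand: "v = (\<Sum>u\<in>U. (v \<bullet> u) *\<^sub>R u)" for v
    using orthonormal_on_expansion[of U id v] U by auto
  have inner: "v \<bullet> w = (\<Sum>u\<in>U. (v \<bullet> u) * (w \<bullet> u))" for v w
  proof -
    have "v \<bullet> w = (\<Sum>u\<in>U. (v \<bullet> u) *\<^sub>R u) \<bullet> w"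
      using expand[of v] by (rule arg_cong)
    also have "\<dots> = (\<Sum>u\<in>U. (v \<bullet> u) * (u \<bullet> w))"
      by (simp add: inner_sum_left)
    finally show ?thesis
      by (simp add: inner_commute)
  qed
  have comp: "(M *v v) \<bullet> u = \<mu> u * (v \<bullet> u)" if "u \<in> U" for u v
  proof -
    have Mu: "M *v u = \<mu> u *\<^sub>R u"
      using U(3) that unfolding \<mu>_def by blast
    have "(M *v v) \<bullet> u = v \<bullet> (M *v u)"
      using symmetric_matrix_inner[OF sym, of v u] by simp
    also have "\<dots> = \<mu> u * (v \<bullet> u)"
      by (simp add: Mu)
    finally show ?thesis .
  qed
  have "eigvals M \<subseteq> \<mu> ` U"
  proof
    fix t assume "t \<in> eigvals M"
    then obtain v where v: "v \<noteq> 0" "M *v v = t *\<^sub>R v"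
      unfolding eigvals_def by auto
    have "\<exists>u\<in>U. v \<bullet> u \<noteq> 0"
    proof (rule ccontr)
      assume "\<not> (\<exists>u\<in>U. v \<bullet> u \<noteq> 0)"
      then have "v \<bullet> v = 0"
        using inner[of v v] by simp
      then show False
        using v(1) by simp
    qed
    then obtain u where u: "u \<in> U" "v \<bullet> u \<noteq> 0"
      by blast
    then have "t = \<mu> u"
      using comp[OF u(1), of v] v(2) by simp
    then show "t \<in> \<mu> ` U"
      using u(1) by blast
  qed
  moreover have "\<mu> ` U \<subseteq> eigvals M"
  proof -
    have "u \<noteq> 0" if "u \<in> U" for u
      using U(2) that unfolding orthonormal_on_def by fastforce
    then show ?thesis
      using U(3) unfolding eigvals_def \<mu>_def by blast
  qed
  ultimately show ?thesis
    using that U(1) inner comp by blast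
qed

lemma norm_le_by_components:
  fixes v w :: "'a::real_inner"
  assumes w: "w \<bullet> w = (\<Sum>u\<in>U. (w \<bullet> u) * (w \<bullet> u))"
    and v: "v \<bullet> v = (\<Sum>u\<in>U. (v \<bullet> u) * (v \<bullet> u))"
    and comp: "\<And>u. u \<in> U \<Longrightarrow> \<bar>w \<bullet> u\<bar> \<le> c * \<bar>v \<bullet> u\<bar>" and "0 \<le> c"
  shows "norm w \<le> c * norm v"
proof -
  have "(norm w)\<^sup>2 = (\<Sum>u\<in>U. \<bar>w \<bullet> u\<bar>\<^sup>2)"
    unfolding power2_norm_eq_inner w by (simp add: power2_eq_square)
  also have "\<dots> \<le> (\<Sum>u\<in>U. (c * \<bar>v \<bullet> u\<bar>)\<^sup>2)"
    using comp by (intro sum_mono power_mono) auto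
  also have "\<dots> = c\<^sup>2 * (\<Sum>u\<in>U. (v \<bullet> u)\<^sup>2)"
    by (simp add: power_mult_distrib sum_distrib_left)
  also have "\<dots> = (c * norm v)\<^sup>2"
    unfolding power_mult_distrib power2_norm_eq_inner v by (simp add: power2_eq_square)
  finally have "(norm w)\<^sup>2 \<le> (c * norm v)\<^sup>2" .
  then show ?thesis
    by (rule power2_le_imp_le) (simp add: \<open>0 \<le> c\<close>)
qed

lemma symmetric_eigvals_finite:
  fixes M :: "real^'n^'n"
  assumes "transpose M = M"
  shows "finite (eigvals M)"
  using symmetric_matrix_eigenbasis[OF assms] by (metis finite_imageI)

lemma symmetric_eigvals_nonempty:
  fixes M :: "real^'n^'n"
  assumes "transpose M = M"
  shows "eigvals M \<noteq> {}"
proof -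
  obtain U :: "(real^'n) set" and \<mu> where U: "eigvals M = \<mu> ` U"
      "\<And>v w. v \<bullet> w = (\<Sum>u\<in>U. (v \<bullet> u) * (w \<bullet> u))"
    using symmetric_matrix_eigenbasis[OF assms] by metis
  obtain b :: "real^'n" where "b \<in> Basis"
    using nonempty_Basis by blast
  then have "b \<bullet> b \<noteq> 0"
    by simp
  then have "U \<noteq> {}"
    using U(2)[of b b] by auto
  then show ?thesis
    using U(1) by simp
qed

lemma symmetric_eigvals_subset_alpha:
  fixes M :: "real^'n^'n"
  assumes "transpose M = M"
  shows "eigvals M \<subseteq> {alpha_min M..alpha_max M}"
  using symmetric_eigvals_finite[OF assms]
  by (auto simp: alpha_min_def alpha_max_def)

lemma symmetric_quadratic_form_ge:
  fixes M :: "real^'n^'n"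
  assumes "transpose M = M" "eigvals M \<subseteq> {a..}"
  shows "a * (v \<bullet> v) \<le> v \<bullet> (M *v v)"
proof -
  obtain U :: "(real^'n) set" and \<mu> where U: "eigvals M = \<mu> ` U"
      "\<And>v w. v \<bullet> w = (\<Sum>u\<in>U. (v \<bullet> u) * (w \<bullet> u))"
      "\<And>u v. u \<in> U \<Longrightarrow> (M *v v) \<bullet> u = \<mu> u * (v \<bullet> u)"
    using symmetric_matrix_eigenbasis[OF assms(1)] by metis
  have "a * (v \<bullet> v) = (\<Sum>u\<in>U. a * (v \<bullet> u)\<^sup>2)"
    using U(2)[of v v] by (simp add: sum_distrib_left power2_eq_square)
  also have "\<dots> \<le> (\<Sum>u\<in>U. \<mu> u * (v \<bullet> u)\<^sup>2)"
    using U(1) assms(2) by (intro sum_mono mult_right_mono) auto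
  also have "\<dots> = v \<bullet> (M *v v)"
    using U(2)[of v "M *v v"] U(3) by (simp add: power2_eq_square algebra_simps)
  finally show ?thesis .
qed

lemma symmetric_norm_matrix_vector_le:
  fixes M :: "real^'n^'n"
  assumes "transpose M = M" "eigvals M \<subseteq> {- c..c}"
  shows "norm (M *v v) \<le> c * norm v"
proof -
  obtain U :: "(real^'n) set" and \<mu> where U: "eigvals M = \<mu> ` U"
      "\<And>v w. v \<bullet> w = (\<Sum>u\<in>U. (v \<bullet> u) * (w \<bullet> u))"
      "\<And>u v. u \<in> U \<Longrightarrow> (M *v v) \<bullet> u = \<mu> u * (v \<bullet> u)"
    using symmetric_matrix_eigenbasis[OF assms(1)] by metis
  obtain t where "t \<in> eigvals M"
    using symmetric_eigvals_nonempty[OF assms(1)] by blast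
  then have c: "0 \<le> c"
    using assms(2) by auto
  have comp: "\<bar>(M *v v) \<bullet> u\<bar> \<le> c * \<bar>v \<bullet> u\<bar>" if "u \<in> U" for u
  proof -
    have "\<bar>\<mu> u\<bar> \<le> c"
      using U(1) assms(2) that by (auto simp: abs_le_iff)
    then show ?thesis
      by (simp add: U(3)[OF that] abs_mult mult_right_mono)
  qed
  show ?thesis
    by (rule norm_le_by_components[OF U(2) U(2) comp c])
qed

lemma symmetric_eigvals_singleton:
  fixes M :: "real^'n^'n"
  assumes "transpose M = M" "eigvals M \<subseteq> {c}"
  shows "M *v v = c *\<^sub>R v"
proof -
  obtain U :: "(real^'n) set" and \<mu> where U: "eigvals M = \<mu> ` U"
      "\<And>v w. v \<bullet> w = (\<Sum>u\<in>U. (v \<bullet> u) * (w \<bullet> u))"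
      "\<And>u v. u \<in> U \<Longrightarrow> (M *v v) \<bullet> u = \<mu> u * (v \<bullet> u)"
    using symmetric_matrix_eigenbasis[OF assms(1)] by metis
  have comp: "\<bar>(M *v v - c *\<^sub>R v) \<bullet> u\<bar> \<le> 0 * \<bar>v \<bullet> u\<bar>" if "u \<in> U" for u
  proof -
    have "\<mu> u = c"
      using U(1) assms(2) that by auto
    then show ?thesis
      by (simp add: U(3)[OF that] inner_diff_left)
  qed
  have "norm (M *v v - c *\<^sub>R v) \<le> 0 * norm v"
    by (rule norm_le_by_components[OF U(2) U(2) comp order_refl])
  then show ?thesis
    by simp
qed

lemma transpose_add_real:
  fixes M N :: "real^'n^'n"
  shows "transpose (M + N) = transpose M + transpose N"
  by (simp add: transpose_def vec_eq_iff)

lemma matrix_vector_add_scalar: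
  fixes M :: "real^'n^'n"
  shows "(M + c *\<^sub>R mat 1) *v v = M *v v + c *\<^sub>R v"
  by (simp add: matrix_vector_mult_add_rdistrib scaleR_matrix_vector_assoc[symmetric])

lemma transpose_add_scalar:
  fixes A :: "real^'n^'n"
  assumes "transpose A = A"
  shows "transpose (A + c *\<^sub>R mat 1) = A + c *\<^sub>R mat 1"
  using assms by (simp add: transpose_add_real transpose_scalar)

lemma eigvals_add_scalar:
  fixes M :: "real^'n^'n"
  shows "eigvals (M + c *\<^sub>R mat 1) = (+) c ` eigvals M"
proof -
  have "t \<in> eigvals (M + c *\<^sub>R mat 1) \<longleftrightarrow> t - c \<in> eigvals M" for t
    unfolding eigvals_def matrix_vector_add_scalar by (simp add: algebra_simps)
  then show ?thesis
    by (force simp: image_iff)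
qed

lemma eigvals_scaleR:
  fixes M :: "real^'n^'n"
  assumes "d \<noteq> 0"
  shows "eigvals (d *\<^sub>R M) = (*) d ` eigvals M"
proof -
  have "d *\<^sub>R w = t *\<^sub>R v \<longleftrightarrow> w = (t / d) *\<^sub>R v" for w v :: "real^'n" and t
  proof
    assume "d *\<^sub>R w = t *\<^sub>R v"
    then have "(1 / d) *\<^sub>R (d *\<^sub>R w) = (1 / d) *\<^sub>R (t *\<^sub>R v)"
      by simp
    then show "w = (t / d) *\<^sub>R v"
      using assms by simp
  qed (use assms in simp)
  then have "t \<in> eigvals (d *\<^sub>R M) \<longleftrightarrow> t / d \<in> eigvals M" for t
    by (simp add: eigvals_def scaleR_matrix_vector_assoc[symmetric])
  then show ?thesis
    using assms by (force simp: image_iff)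
qed

section \<open>Chebyshev polynomials\<close>

fun cheb :: "nat \<Rightarrow> real \<Rightarrow> real" where
  "cheb 0 t = 1"
| "cheb (Suc 0) t = t"
| "cheb (Suc (Suc n)) t = 2 * t * cheb (Suc n) t - cheb n t"

lemma cheb_cos: "cheb n (cos \<theta>) = cos (real n * \<theta>)"
proof (induction n rule: induct_nat_012)
  case (ge2 n)
  have "cos (real (Suc n) * \<theta> + \<theta>) + cos (real (Suc n) * \<theta> - \<theta>) = 2 * cos \<theta> * cos (real (Suc n) * \<theta>)"
    by (simp add: cos_add cos_diff)
  moreover have "real (Suc n) * \<theta> + \<theta> = real (Suc (Suc n)) * \<theta>" "real (Suc n) * \<theta> - \<theta> = real n * \<theta>"
    by (simp_all add: algebra_simps)
  ultimately show ?case
    using ge2 by simp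
qed simp_all

lemma abs_cheb_le_one: "\<bar>t\<bar> \<le> 1 \<Longrightarrow> \<bar>cheb n t\<bar> \<le> 1"
  using cheb_cos[of n "arccos t"] cos_arccos[of t] by (simp add: abs_le_iff)

lemma cheb_mean_inverse:
  assumes "r \<noteq> 0"
  shows "cheb n ((r + 1 / r) / 2) = (r ^ n + (1 / r) ^ n) / 2"
proof (induction n rule: induct_nat_012)
  case (ge2 n)
  let ?t = "(r + 1 / r) / 2"
  have "cheb (Suc (Suc n)) ?t = 2 * ?t * cheb (Suc n) ?t - cheb n ?t"
    by simp
  also have "\<dots> = (r + 1 / r) * ((r ^ Suc n + (1 / r) ^ Suc n) / 2) - (r ^ n + (1 / r) ^ n) / 2"
    by (simp only: ge2) simp
  also have "\<dots> = (r ^ Suc (Suc n) + (1 / r) ^ Suc (Suc n)) / 2"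
    using assms by (simp add: field_simps power_Suc)
  finally show ?case .
qed (use assms in \<open>simp_all add: field_simps\<close>)

lemma cheb_gt_half_power:
  assumes "0 < r"
  shows "r ^ n / 2 < cheb n ((r + 1 / r) / 2)"
  using assms by (simp add: cheb_mean_inverse)

fun cheb_op :: "('a::real_vector \<Rightarrow> 'a) \<Rightarrow> nat \<Rightarrow> 'a \<Rightarrow> 'a" where
  "cheb_op L 0 x = x"
| "cheb_op L (Suc 0) x = L x"
| "cheb_op L (Suc (Suc n)) x = 2 *\<^sub>R L (cheb_op L (Suc n) x) - cheb_op L n x"

lemma inner_cheb_op:
  fixes L :: "'a::real_inner \<Rightarrow> 'a"
  assumes "\<And>v. L v \<bullet> u = l * (v \<bullet> u)"
  shows "cheb_op L n x \<bullet> u = cheb n l * (x \<bullet> u)"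
proof (induction n rule: induct_nat_012)
  case (ge2 n)
  then show ?case
    using assms by (simp add: inner_diff_left algebra_simps)
qed (simp_all add: assms)

lemma cheb_op_minus_cheb_mem:
  assumes lin: "linear L" and sub: "\<And>m. subspace (K m)" and mono: "\<And>m. K m \<subseteq> K (Suc m)"
    and step: "\<And>m v. v \<in> K m \<Longrightarrow> L v \<in> K (Suc m)" and base: "L x - z *\<^sub>R x \<in> K 1"
  shows "cheb_op L n x - cheb n z *\<^sub>R x \<in> K n"
proof (induction n rule: induct_nat_012)
  case 0
  show ?case
    using sub[of 0] by (simp add: subspace_0)
next
  case (ge2 n)
  let ?d1 = "cheb_op L (Suc n) x - cheb (Suc n) z *\<^sub>R x"
  let ?d0 = "cheb_op L n x - cheb n z *\<^sub>R x"
  have le: "K m \<subseteq> K m'" if "m \<le> m'" for m m'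
    using lift_Suc_mono_le[of K, OF mono that] .
  have eq: "cheb_op L (Suc (Suc n)) x - cheb (Suc (Suc n)) z *\<^sub>R x
      = 2 *\<^sub>R L ?d1 + (2 * cheb (Suc n) z) *\<^sub>R (L x - z *\<^sub>R x) - ?d0"
    by (simp add: linear_diff[OF lin] linear_scale[OF lin] algebra_simps)
  have d1: "L ?d1 \<in> K (Suc (Suc n))"
    using step ge2(2) .
  have b: "L x - z *\<^sub>R x \<in> K (Suc (Suc n))"
    using base le[of 1 "Suc (Suc n)"] by auto
  have d0: "?d0 \<in> K (Suc (Suc n))"
    using ge2(1) le[of n "Suc (Suc n)"] by auto
  show ?case
    unfolding eq
    by (rule subspace_diff[OF sub subspace_add[OF sub subspace_scale[OF sub d1] subspace_scale[OF sub b]] d0])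
qed (use base in \<open>metis One_nat_def cheb.simps(2) cheb_op.simps(2)\<close>)

lemma norm_cheb_op_le:
  fixes M :: "real^'n^'n"
  assumes "transpose M = M" "eigvals M \<subseteq> {-1..1}"
  shows "norm (cheb_op ((*v) M) n x) \<le> norm x"
proof -
  obtain U :: "(real^'n) set" and \<mu> where U: "eigvals M = \<mu> ` U"
      "\<And>v w. v \<bullet> w = (\<Sum>u\<in>U. (v \<bullet> u) * (w \<bullet> u))"
      "\<And>u v. u \<in> U \<Longrightarrow> (M *v v) \<bullet> u = \<mu> u * (v \<bullet> u)"
    using symmetric_matrix_eigenbasis[OF assms(1)] by metis
  have comp: "\<bar>cheb_op ((*v) M) n x \<bullet> u\<bar> \<le> 1 * \<bar>x \<bullet> u\<bar>" if "u \<in> U" for u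
  proof -
    have "\<bar>\<mu> u\<bar> \<le> 1"
      using U(1) assms(2) that by (auto simp: abs_le_iff)
    then have "\<bar>cheb n (\<mu> u)\<bar> * \<bar>x \<bullet> u\<bar> \<le> 1 * \<bar>x \<bullet> u\<bar>"
      by (intro mult_right_mono abs_cheb_le_one) simp_all
    then show ?thesis
      by (simp add: inner_cheb_op[OF U(3)[OF that]] abs_mult)
  qed
  have "norm (cheb_op ((*v) M) n x) \<le> 1 * norm x"
    by (rule norm_le_by_components[OF U(2) U(2) comp zero_le_one])
  then show ?thesis
    by simp
qed

section \<open>Krylov spaces and the Lanczos reduction\<close>

lemma subspace_krylov: "subspace (krylov A g k)"
  unfolding krylov_def by (rule subspace_span)

lemma krylov_mono: "m \<le> m' \<Longrightarrow> krylov A g m \<subseteq> krylov A g m'"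
  unfolding krylov_def by (intro span_mono) auto

lemma start_in_krylov: "1 \<le> k \<Longrightarrow> g \<in> krylov A g k"
  unfolding krylov_def by (rule span_base) (auto intro!: exI[of _ 0])

lemma matrix_vector_mult_krylov:
  assumes "v \<in> krylov A g m"
  shows "A *v v \<in> krylov A g (Suc m)"
proof -
  let ?f = "\<lambda>v. A *v v"
  have "?f v \<in> ?f ` span {(?f ^^ j) g | j. j < m}"
    using assms unfolding krylov_def by blast
  also have "\<dots> = span (?f ` {(?f ^^ j) g | j. j < m})"
    using linear_span_image[OF matrix_vector_mul_linear[of A]] by simp
  also have "\<dots> \<subseteq> krylov A g (Suc m)"
    unfolding krylov_def
  proof (intro span_mono image_subsetI)
    fix y assume "y \<in> {(?f ^^ j) g | j. j < m}"
    then obtain j where "j < m" "y = (?f ^^ j) g"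
      by blast
    then show "?f y \<in> {(?f ^^ j) g | j. j < Suc m}"
      by (auto intro!: exI[of _ "Suc j"])
  qed
  finally show ?thesis .
qed

lemma krylov_add_scalar_subset:
  fixes A :: "real^'n^'n"
  shows "krylov (A + c *\<^sub>R mat 1) g k \<subseteq> krylov A g k"
proof -
  let ?f = "\<lambda>v. (A + c *\<^sub>R mat 1) *v v"
  have gen: "(?f ^^ j) g \<in> krylov A g (Suc j)" for j
  proof (induction j)
    case 0
    show ?case
      by (simp add: start_in_krylov)
  next
    case (Suc j)
    have "A *v (?f ^^ j) g \<in> krylov A g (Suc (Suc j))"
      using matrix_vector_mult_krylov[OF Suc] .
    moreover have "(?f ^^ j) g \<in> krylov A g (Suc (Suc j))"
      using Suc krylov_mono[of "Suc j" "Suc (Suc j)"] by auto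
    then have "c *\<^sub>R (?f ^^ j) g \<in> krylov A g (Suc (Suc j))"
      by (rule subspace_scale[OF subspace_krylov])
    ultimately have "A *v (?f ^^ j) g + c *\<^sub>R (?f ^^ j) g \<in> krylov A g (Suc (Suc j))"
      by (rule subspace_add[OF subspace_krylov])
    then show ?case
      by (simp add: matrix_vector_add_scalar)
  qed
  have "{(?f ^^ j) g | j. j < k} \<subseteq> krylov A g k"
  proof
    fix y assume "y \<in> {(?f ^^ j) g | j. j < k}"
    then obtain j where "j < k" "y = (?f ^^ j) g"
      by blast
    then show "y \<in> krylov A g k"
      using gen[of j] krylov_mono[of "Suc j" k A g] by auto
  qed
  then show ?thesis
    unfolding krylov_def[of "A + c *\<^sub>R mat 1"] by (rule span_minimal[OF _ subspace_krylov])
qed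

lemma krylov_add_scalar:
  fixes A :: "real^'n^'n"
  shows "krylov (A + c *\<^sub>R mat 1) g k = krylov A g k"
proof
  have "(A + c *\<^sub>R mat 1) + (- c) *\<^sub>R mat 1 = A"
    by (simp add: algebra_simps)
  then have "krylov A g k = krylov ((A + c *\<^sub>R mat 1) + (- c) *\<^sub>R mat 1) g k"
    by simp
  also have "\<dots> \<subseteq> krylov (A + c *\<^sub>R mat 1) g k"
    by (rule krylov_add_scalar_subset)
  finally show "krylov A g k \<subseteq> krylov (A + c *\<^sub>R mat 1) g k" .
qed (rule krylov_add_scalar_subset)

lemma lanczos_vectors_orthonormal: "lanczos_vectors A g k q \<Longrightarrow> orthonormal_on {1..k} q"
  unfolding lanczos_vectors_def orthonormal_on_def by blast

lemma inner_lanczos_lift: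
  "orthonormal_on {1..k} q \<Longrightarrow> j \<in> {1..k} \<Longrightarrow> lanczos_lift q k h \<bullet> q j = h j"
  unfolding lanczos_lift_def by (rule orthonormal_on_inner_sum) simp_all

lemma norm_lanczos_lift: "orthonormal_on {1..k} q \<Longrightarrow> norm (lanczos_lift q k h) = knorm k h"
  unfolding lanczos_lift_def knorm_def norm_eq_sqrt_inner
  by (simp add: orthonormal_on_inner_sum_self)

lemma lanczos_lift_coordinates:
  "orthonormal_on {1..k} q \<Longrightarrow> y \<in> span (q ` {1..k}) \<Longrightarrow> lanczos_lift q k (\<lambda>i. y \<bullet> q i) = y"
  unfolding lanczos_lift_def by (rule orthonormal_on_expansion[symmetric]) simp_all

lemma trs_obj_lanczos_lift:
  assumes "orthonormal_on {1..k} q" "1 \<le> k" "q 1 = (1 / norm g) *\<^sub>R g" "g \<noteq> 0"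
  shows "trs_obj A g (lanczos_lift q k h) = red_obj A g q k h"
proof -
  have quad: "lanczos_lift q k h \<bullet> (A *v lanczos_lift q k h)
      = (\<Sum>i=1..k. \<Sum>j=1..k. h i * lanczos_T A q i j * h j)"
    unfolding lanczos_lift_def lanczos_T_def
    by (simp add: vec.sum matrix_vector_mult_scaleR inner_sum_left inner_sum_right sum_distrib_left
        algebra_simps) (subst sum.swap, simp add: algebra_simps)
  have "g = norm g *\<^sub>R q 1"
    using assms(3,4) by simp
  then have "lanczos_lift q k h \<bullet> g = norm g * h 1"
    using inner_lanczos_lift[OF assms(1), of 1 h] assms(2) by (metis atLeastAtMost_iff inner_scaleR_right order_refl)
  then show ?thesis
    unfolding trs_obj_def red_obj_def quad by simp
qed

lemma gltr_iterate_minimizes: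
  assumes lanczos: "lanczos_vectors A g k q" and "1 \<le> k" "g \<noteq> 0"
    and h_min: "\<forall>h'. knorm k h' \<le> Delta \<longrightarrow> red_obj A g q k h \<le> red_obj A g q k h'"
    and y: "y \<in> krylov A g k" "norm y \<le> Delta"
  shows "trs_obj A g (lanczos_lift q k h) \<le> trs_obj A g y"
proof -
  have orth: "orthonormal_on {1..k} q"
    using lanczos by (rule lanczos_vectors_orthonormal)
  have span: "span (q ` {1..k}) = krylov A g k" and q1: "q 1 = (1 / norm g) *\<^sub>R g"
    using lanczos \<open>1 \<le> k\<close> unfolding lanczos_vectors_def by auto
  define h' where "h' i = y \<bullet> q i" for i
  have y_lift: "lanczos_lift q k h' = y"
    unfolding h'_def using lanczos_lift_coordinates[OF orth] y(1) span by simp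
  then have "knorm k h' \<le> Delta"
    using norm_lanczos_lift[OF orth, of h'] y(2) by simp
  then have "red_obj A g q k h \<le> red_obj A g q k h'"
    using h_min by blast
  then show "trs_obj A g (lanczos_lift q k h) \<le> trs_obj A g y"
    using trs_obj_lanczos_lift[OF orth \<open>1 \<le> k\<close> q1 \<open>g \<noteq> 0\<close>] y_lift by metis
qed

section \<open>The objective on the trust-region sphere\<close>

lemma infdist_subspace_orthogonal:
  fixes x p :: "'a::real_inner"
  assumes "subspace S" "p \<in> S" and orth: "\<And>w. w \<in> S \<Longrightarrow> (x - p) \<bullet> w = 0"
  shows "infdist x S = norm (x - p)"
proof (rule antisym)
  show "infdist x S \<le> norm (x - p)"
    using infdist_le[OF assms(2)] by (simp add: dist_norm)
  have "norm (x - p) \<le> dist x z" if "z \<in> S" for z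
  proof -
    have "(x - p) \<bullet> (p - z) = 0"
      using orth assms(1,2) that by (simp add: subspace_diff)
    then have "(norm (x - z))\<^sup>2 = (norm (x - p))\<^sup>2 + (norm (p - z))\<^sup>2"
      using norm_add_Pythagorean[of "x - p" "p - z"] by (simp add: orthogonal_def)
    then show ?thesis
      by (simp add: dist_norm power2_le_imp_le)
  qed
  moreover have "S \<noteq> {}"
    using assms(2) by blast
  ultimately show "norm (x - p) \<le> infdist x S"
    unfolding infdist_notempty[OF \<open>S \<noteq> {}\<close>] by (intro cINF_greatest)
qed

lemma sphere_point_distance_ineq:
  fixes s D :: real
  assumes "0 \<le> s" "s \<le> D"
  shows "2 * D\<^sup>2 - 2 * D * s \<le> (1 + (D\<^sup>2 - s\<^sup>2) / D\<^sup>2) * (D\<^sup>2 - s\<^sup>2)"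
proof (cases "D = 0")
  case False
  have "(1 + (D\<^sup>2 - s\<^sup>2) / D\<^sup>2) * (D\<^sup>2 - s\<^sup>2) - (2 * D\<^sup>2 - 2 * D * s) = s * (D - s)\<^sup>2 * (2 * D + s) / D\<^sup>2"
    using False by (simp add: field_simps power2_eq_square)
  moreover have "0 \<le> s * (D - s)\<^sup>2 * (2 * D + s) / D\<^sup>2"
    using assms by simp
  ultimately show ?thesis
    by linarith
qed (use assms in simp)

text \<open>Rescaling the orthogonal projection \<open>p\<close> of \<open>x\<close> onto the sphere gives a point of \<open>S\<close>
  whose squared distance to \<open>x\<close> is \<open>2\<Delta>(\<Delta> - |p|)\<close>, with \<open>|p|\<^sup>2 = \<Delta>\<^sup>2 - e\<^sup>2\<close>.\<close>

lemma subspace_sphere_point_near: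
  fixes x v :: "'a::euclidean_space"
  assumes S: "subspace S" and v: "v \<in> S" "v \<noteq> 0" and x: "norm x = Delta" and "0 < Delta"
  obtains y where "y \<in> S" "norm y = Delta"
    "(norm (y - x))\<^sup>2 \<le> (1 + (infdist x S)\<^sup>2 / Delta\<^sup>2) * (infdist x S)\<^sup>2"
proof -
  obtain p r where p: "p \<in> span S" and r: "\<And>w. w \<in> span S \<Longrightarrow> orthogonal r w" and xpr: "x = p + r"
    using orthogonal_subspace_decomp_exists[of S x] by metis
  have spanS: "span S = S"
    using S by (simp add: span_eq_iff)
  have pS: "p \<in> S" and rS: "\<And>w. w \<in> S \<Longrightarrow> r \<bullet> w = 0"
    using p r by (simp_all add: spanS orthogonal_def)
  have e: "infdist x S = norm r"
    using infdist_subspace_orthogonal[OF S pS] rS xpr by simp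
  have pyth: "Delta\<^sup>2 = (norm p)\<^sup>2 + (norm r)\<^sup>2"
    using x xpr rS[OF pS] norm_add_Pythagorean[of p r] by (simp add: orthogonal_def inner_commute)
  obtain d where d: "d \<in> S" "norm d = 1" "d \<bullet> p = norm p"
  proof (cases "p = 0")
    case True
    then show ?thesis
      using that[of "(1 / norm v) *\<^sub>R v"] v S by (simp add: subspace_scale)
  next
    case False
    then show ?thesis
      using that[of "(1 / norm p) *\<^sub>R p"] pS S by (simp add: subspace_scale dot_square_norm power2_eq_square)
  qed
  define y where "y = Delta *\<^sub>R d"
  have "y \<in> S" "norm y = Delta"
    using d S \<open>0 < Delta\<close> by (simp_all add: y_def subspace_scale)
  have "y \<bullet> x = Delta * norm p"
    using d rS[OF d(1)] by (simp add: y_def xpr inner_add_right inner_commute)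
  have "(norm (y - x))\<^sup>2 = (norm y)\<^sup>2 - 2 * (y \<bullet> x) + (norm x)\<^sup>2"
    by (simp add: power2_norm_eq_inner inner_diff_left inner_diff_right inner_commute)
  also have "\<dots> = 2 * Delta\<^sup>2 - 2 * Delta * norm p"
    using \<open>norm y = Delta\<close> x \<open>y \<bullet> x = Delta * norm p\<close> by simp
  also have "\<dots> \<le> (1 + (Delta\<^sup>2 - (norm p)\<^sup>2) / Delta\<^sup>2) * (Delta\<^sup>2 - (norm p)\<^sup>2)"
    using pyth \<open>0 < Delta\<close> by (intro sphere_point_distance_ineq) (auto intro: power2_le_imp_le)
  also have "\<dots> = (1 + (infdist x S)\<^sup>2 / Delta\<^sup>2) * (infdist x S)\<^sup>2"
    using pyth e by simp
  finally show ?thesis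
    using that \<open>y \<in> S\<close> \<open>norm y = Delta\<close> by blast
qed

lemma trs_obj_diff_sphere:
  fixes A :: "real^'n^'n"
  assumes sym: "transpose A = A" and x: "(A + lam *\<^sub>R mat 1) *v x = - g" and y: "norm y = norm x"
  shows "trs_obj A g y - trs_obj A g x = 1/2 * ((y - x) \<bullet> ((A + lam *\<^sub>R mat 1) *v (y - x)))"
proof -
  have g: "g = - (A *v x + lam *\<^sub>R x)"
    using x by (simp add: matrix_vector_add_scalar)
  have "x \<bullet> (A *v y) = y \<bullet> (A *v x)"
    using symmetric_matrix_inner[OF sym, of x y] by (simp add: inner_commute)
  moreover have "y \<bullet> y = x \<bullet> x"
    using y by (simp add: dot_square_norm)
  ultimately show ?thesis
    unfolding trs_obj_def g matrix_vector_add_scalar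
    by (simp add: inner_diff_left inner_diff_right matrix_vector_mult_diff_distrib algebra_simps
        inner_commute)
qed

lemma inner_le_onorm:
  fixes f :: "'a::real_inner \<Rightarrow> 'a"
  assumes "bounded_linear f"
  shows "v \<bullet> f v \<le> onorm f * (v \<bullet> v)"
proof -
  have "v \<bullet> f v \<le> norm v * norm (f v)"
    by (rule norm_cauchy_schwarz)
  also have "\<dots> \<le> norm v * (onorm f * norm v)"
    by (rule mult_left_mono[OF onorm[OF assms] norm_ge_zero])
  also have "\<dots> = onorm f * (v \<bullet> v)"
    by (simp add: dot_square_norm power2_eq_square)
  finally show ?thesis .
qed



section \<open>Chebyshev approximation in the Krylov space\<close>

lemma chebyshev_condition_parameter:
  fixes p q :: real
  assumes "0 < p" "p < q"
  defines "r \<equiv> (q + p) / (q - p)"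
  shows "0 < r" and "(r + 1 / r) / 2 = (q\<^sup>2 + p\<^sup>2) / (q\<^sup>2 - p\<^sup>2)"
    and "1 / r = (q / p - 1) / (q / p + 1)"
proof -
  have pq: "0 < q + p" "0 < q - p"
    using assms by linarith+
  then show "0 < r"
    unfolding r_def by (rule divide_pos_pos)
  have "r + 1 / r = ((q + p) * (q + p) + (q - p) * (q - p)) / ((q - p) * (q + p))"
    unfolding r_def using pq by (simp add: field_simps)
  also have "\<dots> = 2 * ((q\<^sup>2 + p\<^sup>2) / (q\<^sup>2 - p\<^sup>2))"
    by (simp add: power2_eq_square algebra_simps)
  finally show "(r + 1 / r) / 2 = (q\<^sup>2 + p\<^sup>2) / (q\<^sup>2 - p\<^sup>2)"
    by (metis nonzero_mult_div_cancel_left zero_neq_numeral)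
  have "q / p - 1 = (q - p) / p" "q / p + 1 = (q + p) / p"
    using \<open>0 < p\<close> by (simp_all add: field_simps)
  then show "1 / r = (q / p - 1) / (q / p + 1)"
    unfolding r_def using pq \<open>0 < p\<close> by simp
qed

text \<open>The witness is \<open>T\<^sub>k(L) x\<close>, for \<open>L\<close> the affine image of \<open>P\<close> mapping \<open>[a, b]\<close> onto \<open>[-1, 1]\<close>.\<close>

lemma krylov_chebyshev_residual:
  fixes P :: "real^'n^'n"
  assumes sym: "transpose P = P" and eig: "eigvals P \<subseteq> {a..b}" and "a < b"
    and x: "P *v x \<in> krylov P g 1"
  obtains w where "w - cheb k ((b + a) / (b - a)) *\<^sub>R x \<in> krylov P g k" "norm w \<le> norm x"
proof -
  define d where "d = - 2 / (b - a)"
  define z where "z = (b + a) / (b - a)"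
  define L where "L = d *\<^sub>R P + z *\<^sub>R mat 1"
  have Lv: "L *v v = d *\<^sub>R (P *v v) + z *\<^sub>R v" for v
    unfolding L_def matrix_vector_add_scalar scaleR_matrix_vector_assoc ..
  have d: "d \<noteq> 0"
    using \<open>a < b\<close> by (simp add: d_def)
  have symL: "transpose L = L"
    unfolding L_def using sym by (simp add: transpose_add_scalar transpose_scalar)
  have "z + d * t \<in> {-1..1}" if "t \<in> {a..b}" for t
  proof -
    have "z + d * t = ((b + a) - 2 * t) / (b - a)"
      by (simp add: z_def d_def diff_divide_distrib)
    then show ?thesis
      using that \<open>a < b\<close> by (simp add: divide_le_eq le_divide_eq)
  qed
  then have eigL: "eigvals L \<subseteq> {-1..1}"
    using eig unfolding L_def eigvals_add_scalar eigvals_scaleR[OF d] by auto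
  have step: "L *v v \<in> krylov P g (Suc m)" if "v \<in> krylov P g m" for m v
  proof -
    have "v \<in> krylov P g (Suc m)"
      using that krylov_mono[of m "Suc m"] by auto
    then show ?thesis
      unfolding Lv using matrix_vector_mult_krylov[OF that]
      by (intro subspace_add[OF subspace_krylov] subspace_scale[OF subspace_krylov])
  qed
  have "L *v x - z *\<^sub>R x \<in> krylov P g 1"
    unfolding Lv using subspace_scale[OF subspace_krylov x] by simp
  then have "cheb_op ((*v) L) k x - cheb k z *\<^sub>R x \<in> krylov P g k"
    by (intro cheb_op_minus_cheb_mem[where K = "krylov P g"] matrix_vector_mul_linear
        subspace_krylov krylov_mono step) simp_all
  moreover have "norm (cheb_op ((*v) L) k x) \<le> norm x"
    by (rule norm_cheb_op_le[OF symL eigL])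
  ultimately show ?thesis
    using that unfolding z_def by blast
qed

lemma krylov_chebyshev_infdist:
  fixes P :: "real^'n^'n"
  assumes sym: "transpose P = P" and eig: "eigvals P \<subseteq> {a..b}" and "0 < a"
    and x: "P *v x \<in> krylov P g 1" and "1 \<le> k"
  shows "infdist x (krylov P g k) \<le> 2 * ((sqrt (b / a) - 1) / (sqrt (b / a) + 1)) ^ k * norm x"
    (is "_ \<le> 2 * ?\<rho> ^ k * _")
proof -
  obtain t where "t \<in> eigvals P"
    using symmetric_eigvals_nonempty[OF sym] by blast
  then have "a \<le> b"
    using eig by auto
  then have "0 \<le> ?\<rho>"
    using \<open>0 < a\<close> by simp
  then have rhs: "0 \<le> 2 * ?\<rho> ^ k * norm x"
    by simp
  show ?thesis
  proof (cases "a = b")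
    case True
    then have "P *v v = a *\<^sub>R v" for v
      using eig symmetric_eigvals_singleton[OF sym] by auto
    then have "x = (1 / a) *\<^sub>R (P *v x)"
      using \<open>0 < a\<close> by simp
    then have "x \<in> krylov P g k"
      using x krylov_mono[OF \<open>1 \<le> k\<close>] subspace_scale[OF subspace_krylov] by (metis subsetD)
    then show ?thesis
      using rhs by simp
  next
    case False
    with \<open>a \<le> b\<close> have "a < b"
      by simp
    have "0 < sqrt a" "sqrt a < sqrt b"
      using \<open>0 < a\<close> \<open>a < b\<close> by simp_all
    define r where "r = (sqrt b + sqrt a) / (sqrt b - sqrt a)"
    note r = chebyshev_condition_parameter[OF \<open>0 < sqrt a\<close> \<open>sqrt a < sqrt b\<close>, folded r_def]
    have sq: "(sqrt a)\<^sup>2 = a" "(sqrt b)\<^sup>2 = b"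
      using \<open>0 < a\<close> \<open>a < b\<close> by simp_all
    have z: "(r + 1 / r) / 2 = (b + a) / (b - a)"
      using r(2)[unfolded sq] .
    have \<rho>: "1 / r = ?\<rho>"
      using r(3) by (simp add: real_sqrt_divide)
    define T where "T = cheb k ((b + a) / (b - a))"
    have "r ^ k / 2 < T"
      unfolding T_def z[symmetric] using cheb_gt_half_power[OF r(1)] .
    moreover have "0 < r ^ k"
      using r(1) by simp
    ultimately have "0 < T"
      by linarith
    have "1 / T \<le> 1 / (r ^ k / 2)"
      using \<open>r ^ k / 2 < T\<close> \<open>0 < r ^ k\<close> by (intro divide_left_mono) auto
    also have "\<dots> = 2 * (1 / r) ^ k"
      by (simp add: power_one_over)
    finally have T: "0 < T" "1 / T \<le> 2 * ?\<rho> ^ k"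
      using \<open>0 < T\<close> by (simp_all only: \<rho>)
    obtain w where w: "w - T *\<^sub>R x \<in> krylov P g k" "norm w \<le> norm x"
      using krylov_chebyshev_residual[OF sym eig \<open>a < b\<close> x] unfolding T_def by blast
    have "x - (1 / T) *\<^sub>R w = (- 1 / T) *\<^sub>R (w - T *\<^sub>R x)"
      using T(1) by (simp add: algebra_simps)
    then have "x - (1 / T) *\<^sub>R w \<in> krylov P g k"
      using subspace_scale[OF subspace_krylov w(1)] by metis
    then have "infdist x (krylov P g k) \<le> norm w / T"
      using infdist_le[of "x - (1 / T) *\<^sub>R w" "krylov P g k" x] T(1) by (simp add: dist_norm)
    also have "\<dots> \<le> norm x * (1 / T)"
      using w(2) T(1) by (simp add: divide_right_mono)
    also have "\<dots> \<le> norm x * (2 * ?\<rho> ^ k)"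
      by (rule mult_left_mono[OF T(2) norm_ge_zero])
    finally show ?thesis
      by (simp add: algebra_simps)
  qed
qed

section \<open>Error bounds\<close>

lemma trs_obj_gap_sphere_ge:
  fixes A :: "real^'n^'n"
  assumes sym: "transpose A = A" and x: "(A + lam *\<^sub>R mat 1) *v x = - g"
    and eig: "eigvals (A + lam *\<^sub>R mat 1) \<subseteq> {a..}" and y: "norm y = norm x"
  shows "a / 2 * (norm (y - x))\<^sup>2 \<le> trs_obj A g y - trs_obj A g x"
  using symmetric_quadratic_form_ge[OF transpose_add_scalar[OF sym] eig, of "y - x"]
  unfolding trs_obj_diff_sphere[OF sym x y] by (simp add: power2_norm_eq_inner)

lemma trs_obj_gap_sphere_le:
  fixes A :: "real^'n^'n"
  assumes sym: "transpose A = A" and x: "(A + lam *\<^sub>R mat 1) *v x = - g" and y: "norm y = norm x"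
  shows "trs_obj A g y - trs_obj A g x \<le> onorm ((*v) (A + lam *\<^sub>R mat 1)) / 2 * (norm (y - x))\<^sup>2"
  using inner_le_onorm[OF matrix_vector_mul_bounded_linear, of "y - x" "A + lam *\<^sub>R mat 1"]
  unfolding trs_obj_diff_sphere[OF sym x y] by (simp add: power2_norm_eq_inner)

lemma trs_subspace_minimizer_gap:
  fixes A :: "real^'n^'n"
  assumes sym: "transpose A = A" and x: "(A + lam *\<^sub>R mat 1) *v x = - g"
    and S: "subspace S" "v \<in> S" "v \<noteq> 0" and Delta: "norm x = Delta" "0 < Delta"
    and xk_min: "\<And>y. y \<in> S \<Longrightarrow> norm y \<le> Delta \<Longrightarrow> trs_obj A g xk \<le> trs_obj A g y"
  shows "trs_obj A g xk - trs_obj A g x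
    \<le> 1/2 * onorm ((*v) (A + lam *\<^sub>R mat 1)) * (1 + (infdist x S)\<^sup>2 / Delta\<^sup>2) * (infdist x S)\<^sup>2"
proof -
  obtain y where y: "y \<in> S" "norm y = Delta"
      "(norm (y - x))\<^sup>2 \<le> (1 + (infdist x S)\<^sup>2 / Delta\<^sup>2) * (infdist x S)\<^sup>2"
    using subspace_sphere_point_near[OF S Delta] by blast
  let ?n = "onorm ((*v) (A + lam *\<^sub>R mat 1))"
  have "0 \<le> ?n"
    by (rule onorm_pos_le[OF matrix_vector_mul_bounded_linear])
  have "trs_obj A g xk \<le> trs_obj A g y"
    using xk_min y(1,2) by simp
  also have "\<dots> \<le> trs_obj A g x + ?n / 2 * (norm (y - x))\<^sup>2"
    using trs_obj_gap_sphere_le[OF sym x] y(2) Delta(1) by (metis add.commute diff_le_eq)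
  also have "\<dots> \<le> trs_obj A g x + ?n / 2 * ((1 + (infdist x S)\<^sup>2 / Delta\<^sup>2) * (infdist x S)\<^sup>2)"
    using y(3) \<open>0 \<le> ?n\<close> by (simp add: mult_left_mono)
  also have "\<dots> = trs_obj A g x + 1/2 * ?n * (1 + (infdist x S)\<^sup>2 / Delta\<^sup>2) * (infdist x S)\<^sup>2"
    by (simp add: algebra_simps)
  finally show ?thesis
    by linarith
qed

lemma trs_subspace_minimizer_dist:
  fixes A :: "real^'n^'n"
  assumes sym: "transpose A = A" and x: "(A + lam *\<^sub>R mat 1) *v x = - g"
    and eig: "eigvals (A + lam *\<^sub>R mat 1) \<subseteq> {a..b}" and "0 < a"
    and S: "subspace S" "v \<in> S" "v \<noteq> 0" and Delta: "norm x = Delta" "0 < Delta"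
    and xk_min: "\<And>y. y \<in> S \<Longrightarrow> norm y \<le> Delta \<Longrightarrow> trs_obj A g xk \<le> trs_obj A g y"
    and xk: "norm xk = Delta"
  shows "norm (xk - x) \<le> sqrt (b / a * (1 + (infdist x S)\<^sup>2 / Delta\<^sup>2)) * infdist x S"
proof -
  define E where "E = (1 + (infdist x S)\<^sup>2 / Delta\<^sup>2) * (infdist x S)\<^sup>2"
  have "0 \<le> E"
    unfolding E_def by simp
  have "onorm ((*v) (A + lam *\<^sub>R mat 1)) \<le> b"
  proof (rule onorm_le)
    show "norm ((A + lam *\<^sub>R mat 1) *v v) \<le> b * norm v" for v
      using eig \<open>0 < a\<close>
      by (intro symmetric_norm_matrix_vector_le[OF transpose_add_scalar[OF sym]]) auto
  qed
  have "a / 2 * (norm (xk - x))\<^sup>2 \<le> trs_obj A g xk - trs_obj A g x"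
    using eig xk Delta(1) by (intro trs_obj_gap_sphere_ge[OF sym x]) auto
  also have "\<dots> \<le> onorm ((*v) (A + lam *\<^sub>R mat 1)) / 2 * E"
    using trs_subspace_minimizer_gap[OF sym x S Delta xk_min] unfolding E_def by simp
  also have "\<dots> \<le> b / 2 * E"
    using \<open>onorm ((*v) (A + lam *\<^sub>R mat 1)) \<le> b\<close> \<open>0 \<le> E\<close> by (intro mult_right_mono) simp_all
  finally have "(norm (xk - x))\<^sup>2 \<le> (b / a * (1 + (infdist x S)\<^sup>2 / Delta\<^sup>2)) * (infdist x S)\<^sup>2"
    using \<open>0 < a\<close> unfolding E_def by (simp add: field_simps)
  then have "norm (xk - x) \<le> sqrt ((b / a * (1 + (infdist x S)\<^sup>2 / Delta\<^sup>2)) * (infdist x S)\<^sup>2)"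
    by (rule real_le_rsqrt)
  also have "\<dots> = sqrt (b / a * (1 + (infdist x S)\<^sup>2 / Delta\<^sup>2)) * infdist x S"
    unfolding real_sqrt_mult real_sqrt_abs abs_of_nonneg[OF infdist_nonneg] ..
  finally show ?thesis .
qed

lemma chebyshev_rate_bounds:
  fixes e D t c \<kappa> :: real
  assumes "0 \<le> e" "e \<le> 2 * t * D" "0 < D" "0 \<le> c" "0 \<le> \<kappa>"
  shows "1/2 * c * (1 + e\<^sup>2 / D\<^sup>2) * e\<^sup>2 \<le> 2 * c * (D\<^sup>2 + e\<^sup>2) * t\<^sup>2"
    and "sqrt (\<kappa> * (1 + e\<^sup>2 / D\<^sup>2)) * e \<le> 2 * sqrt (\<kappa> * (D\<^sup>2 + e\<^sup>2)) * t"
proof -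
  have "e / D \<le> 2 * t"
    using assms(2,3) by (simp add: divide_le_eq)
  moreover have "0 \<le> e / D"
    using assms(1,3) by simp
  ultimately have ratio: "(e / D)\<^sup>2 \<le> 4 * t\<^sup>2"
    using power_mono[of "e / D" "2 * t" 2] by (simp add: power_mult_distrib)
  have split: "(1 + e\<^sup>2 / D\<^sup>2) * e\<^sup>2 = (D\<^sup>2 + e\<^sup>2) * (e / D)\<^sup>2"
    using assms(3) by (simp add: field_simps power2_eq_square)
  have "1/2 * c * (1 + e\<^sup>2 / D\<^sup>2) * e\<^sup>2 = 1/2 * c * (D\<^sup>2 + e\<^sup>2) * (e / D)\<^sup>2"
    by (simp only: mult.assoc split)
  also have "\<dots> \<le> 1/2 * c * (D\<^sup>2 + e\<^sup>2) * (4 * t\<^sup>2)"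
    using ratio assms(4) by (intro mult_left_mono) simp_all
  also have "\<dots> = 2 * c * (D\<^sup>2 + e\<^sup>2) * t\<^sup>2"
    by simp
  finally show "1/2 * c * (1 + e\<^sup>2 / D\<^sup>2) * e\<^sup>2 \<le> 2 * c * (D\<^sup>2 + e\<^sup>2) * t\<^sup>2" .
  have "sqrt (\<kappa> * (1 + e\<^sup>2 / D\<^sup>2)) * e = sqrt (\<kappa> * (D\<^sup>2 + e\<^sup>2)) * (e / D)"
    using assms(1,3) by (simp add: field_simps real_sqrt_mult real_sqrt_divide)
  also have "\<dots> \<le> sqrt (\<kappa> * (D\<^sup>2 + e\<^sup>2)) * (2 * t)"
    using \<open>e / D \<le> 2 * t\<close> by (rule mult_left_mono) (simp add: assms(5))
  finally show "sqrt (\<kappa> * (1 + e\<^sup>2 / D\<^sup>2)) * e \<le> 2 * sqrt (\<kappa> * (D\<^sup>2 + e\<^sup>2)) * t"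
    by (simp add: algebra_simps)
qed

theorem theorem3p3:
  fixes A :: "real^'n^'n" and g x_opt :: "real^'n" and Delta lam_opt :: real
    and k :: nat and q :: "nat \<Rightarrow> real^'n" and h :: "nat \<Rightarrow> real"
  assumes symA: "transpose A = A"
    and g_nz: "g \<noteq> 0"
    and Delta_pos: "Delta > 0"
    and xopt_feas: "norm x_opt \<le> Delta"
    and xopt_min: "\<forall>y. norm y \<le> Delta \<longrightarrow> trs_obj A g x_opt \<le> trs_obj A g y"
    and lam_nonneg: "lam_opt \<ge> 0"
    and lam_eq: "(A + lam_opt *\<^sub>R mat 1) *v x_opt = - g"
    and lam_compl: "lam_opt * (Delta - norm x_opt) = 0"
    and lam_psd: "\<forall>v. 0 \<le> v \<bullet> ((A + lam_opt *\<^sub>R mat 1) *v v)"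
    and easy: "lam_opt > - alpha_min A"
    and k_range: "1 \<le> k" "k \<le> kmax A g"
    and lanczos: "lanczos_vectors A g k q"
    and h_feas: "knorm k h \<le> Delta"
    and h_min: "\<forall>h'. knorm k h' \<le> Delta \<longrightarrow> red_obj A g q k h \<le> red_obj A g q k h'"
    and bdry: "norm x_opt = Delta" "norm (lanczos_lift q k h) = Delta"
  shows
    "let A_opt = A + lam_opt *\<^sub>R mat 1;
         kappa = (alpha_max A + lam_opt) / (alpha_min A + lam_opt);
         x_k = lanczos_lift q k h;
         eps = infdist x_opt (krylov A g k);
         rho = (sqrt kappa - 1) / (sqrt kappa + 1);
         nA = onorm (\<lambda>v. A_opt *v v)
     in 0 \<le> trs_obj A g x_k - trs_obj A g x_opt
      \<and> trs_obj A g x_k - trs_obj A g x_opt \<le> (1/2) * nA * (1 + eps^2 / Delta^2) * eps^2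
      \<and> (1/2) * nA * (1 + eps^2 / Delta^2) * eps^2 \<le> 2 * nA * (Delta^2 + eps^2) * rho^(2*k)
      \<and> norm (x_k - x_opt) \<le> sqrt (kappa * (1 + eps^2 / Delta^2)) * eps
      \<and> sqrt (kappa * (1 + eps^2 / Delta^2)) * eps \<le> 2 * sqrt (kappa * (Delta^2 + eps^2)) * rho^k"
proof -
  let ?P = "A + lam_opt *\<^sub>R mat 1"
  let ?a = "alpha_min A + lam_opt" and ?b = "alpha_max A + lam_opt"
  let ?K = "krylov A g k" and ?x_k = "lanczos_lift q k h"
  let ?\<rho> = "(sqrt (?b / ?a) - 1) / (sqrt (?b / ?a) + 1)"
  have eig: "eigvals ?P \<subseteq> {?a..?b}"
    using symmetric_eigvals_subset_alpha[OF symA] unfolding eigvals_add_scalar by auto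
  have "0 < ?a"
    using easy by simp
  have gK: "g \<in> ?K"
    using k_range(1) by (rule start_in_krylov)
  note gltr = gltr_iterate_minimizes[OF lanczos k_range(1) g_nz h_min]
  have Px: "?P *v x_opt \<in> krylov ?P g 1"
    unfolding lam_eq by (rule subspace_neg[OF subspace_krylov start_in_krylov]) simp
  have rate: "infdist x_opt ?K \<le> 2 * ?\<rho> ^ k * Delta"
    using krylov_chebyshev_infdist[OF transpose_add_scalar[OF symA] eig \<open>0 < ?a\<close> Px k_range(1)]
    by (simp add: krylov_add_scalar bdry(1))
  have "0 \<le> ?b / ?a"
    using eig symmetric_eigvals_nonempty[OF transpose_add_scalar[OF symA]] \<open>0 < ?a\<close> by fastforce
  note rate_bounds = chebyshev_rate_bounds[OF infdist_nonneg rate Delta_pos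
      onorm_pos_le[OF matrix_vector_mul_bounded_linear] \<open>0 \<le> ?b / ?a\<close>]
  have "0 \<le> trs_obj A g ?x_k - trs_obj A g x_opt"
    using xopt_min bdry(2) Delta_pos by simp
  moreover have "trs_obj A g ?x_k - trs_obj A g x_opt
      \<le> 1/2 * onorm ((*v) ?P) * (1 + (infdist x_opt ?K)\<^sup>2 / Delta\<^sup>2) * (infdist x_opt ?K)\<^sup>2"
    by (rule trs_subspace_minimizer_gap[OF symA lam_eq subspace_krylov gK g_nz bdry(1) Delta_pos gltr])
  moreover have "norm (?x_k - x_opt) \<le> sqrt (?b / ?a * (1 + (infdist x_opt ?K)\<^sup>2 / Delta\<^sup>2)) * infdist x_opt ?K"
    by (rule trs_subspace_minimizer_dist[OF symA lam_eq eig \<open>0 < ?a\<close> subspace_krylov gK g_nz bdry(1)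
          Delta_pos gltr bdry(2)])
  ultimately show ?thesis
    unfolding Let_def power_even_eq using rate_bounds by blast
qed

end
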